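(* Let $(\mathcal{C},G,\varphi)$ be a category system with $\mathcal{C}$ a finitely aligned left cancellative small category, let $\mathcal{D}=\mathcal{C}\rtimes^\varphi G$ be its Zappa-Szép product, and let $B$ be a $C^*$-algebra. Let $(T,U)$ be a representation of $(\mathcal{C},G,\varphi)$ in $B$ and let $R=T\times U$ be the associated nondegenerate representation of $\mathcal{D}$ in $B$, given by $R_{(\alpha,g)}=T_\alpha U_g$. Then $(T,U)$ is covariant (i.e. the representation $T$ of $\mathcal{C}$ is covariant) if and only if the representation $R$ of $\mathcal{D}$ is covariant.
   Context: Small categories: a small category $\mathcal{C}$ is identified with its set of morphisms; $\mathcal{C}^0\subseteq\mathcal{C}$ (nonempty) is the set of vertices (objects, identified with identity morphisms), $r,s\colon\mathcal{C}\to\mathcal{C}^0$ are the range and source maps, and $\alpha\beta$ is defined iff $s(\alpha)=r(\beta)$. $\mathcal{C}$ is left cancellative if $\alpha\beta=\alpha\gamma$ implies $\beta=\gamma$. Write $\alpha\mathcal{C}=\{\alpha\beta: r(\beta)=s(\alpha)\}$ and, for $v\in\mathcal{C}^0$, $v\mathcal{C}=r^{-1}(v)$. $\mathcal{C}$ is finitely aligned if for all $\alpha,\beta\in\mathcal{C}$ there is a finite (possibly empty) $F\subseteq\mathcal{C}$ with $\alpha\mathcal{C}\cap\beta\mathcal{C}=\bigcup_{\gamma\in F}\gamma\mathcal{C}$. A set $F$ is independent if $\gamma\notin\gamma'\mathcal{C}$ for all distinct $\gamma,\gamma'\in F$. One writes $\alpha\vee\beta$ for any finite independent $F$ with $\alpha\mathcal{C}\cap\beta\mathcal{C}=\bigcup_{\gamma\in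 F}\gamma\mathcal{C}$; it is unique up to replacing elements $\gamma$ by $\gamma\delta$ with $\delta$ invertible. A subset $F\subseteq v\mathcal{C}$ is exhaustive at $v\in\mathcal{C}^0$ if for every $\alpha\in v\mathcal{C}$ there is $\beta\in F$ with $\alpha\mathcal{C}\cap\beta\mathcal{C}\neq\varnothing$. Representations: a representation of a finitely aligned left cancellative small category $\mathcal{C}$ in a $C^*$-algebra $B$ is a map $T\colon\mathcal{C}\to B$ such that for all $\alpha,\beta\in\mathcal{C}$: (1) $T_\alpha^*T_\alpha=T_{s(\alpha)}$; (2) $T_\alpha T_\beta=T_{\alpha\beta}$ if $s(\alpha)=r(\beta)$; (3) $T_\alpha T_\alpha^*T_\beta T_\beta^*=\bigvee_{\gamma\in\alpha\vee\beta}T_\gamma T_\gamma^*$ (join of projections, a priori taken in $B^{**}$; the empty join is $0$). $T$ is covariant if moreover (4) $T_v=\bigvee_{\alpha\in F}T_\alpha T_\alpha^*$ for every $v\in\mathcal{C}^0$ and every finite exhaustive set $F$ at $v$. $T$ is nondegenerate if $\sum_{v\in\mathcal{C}^0}T_v$ converges strictly to $1$ in the multiplier algebra $M(B)$. Category systems: $G$ is a discrete group acting on the set $\mathcal{C}$ by permutations, with $r(g\alpha)=gr(\alpha)$ and $s(g\alpha)=gs(\alpha)$ (not necessarily by automorphisms of the category). A category cocycle is a map $\varphi\colon G\times\mathcal{C}\to G$ such that $\varphi(gh,\alpha)=\varphi(g,h\alpha)\varphi(h,\alpha)$ for all $g,h\in G$, $\alpha\in\mathcal{C}$, and, for all $g\in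 G$, $v\in\mathcal{C}^0$ and $\alpha,\beta\in\mathcal{C}$ with $s(\alpha)=r(\beta)$: $\varphi(g,v)=g$; $\varphi(g,\alpha)s(\alpha)=gs(\alpha)$; $g(\alpha\beta)=(g\alpha)(\varphi(g,\alpha)\beta)$; $\varphi(g,\alpha\beta)=\varphi(\varphi(g,\alpha),\beta)$. Then $(\mathcal{C},G,\varphi)$ is called a category system. Zappa-Szép product: $\mathcal{D}=\mathcal{C}\rtimes^\varphi G$ is the set $\mathcal{C}\times G$ with $\mathcal{D}^0=\mathcal{C}^0\times\{1\}$, $r(\alpha,g)=(r(\alpha),1)$, $s(\alpha,g)=(g^{-1}s(\alpha),1)$ and $(\alpha,g)(\beta,h)=(\alpha(g\beta),\varphi(g,\beta)h)$ whenever $s(\alpha,g)=r(\beta,h)$. It is a finitely aligned left cancellative small category when $\mathcal{C}$ is. A representation of the category system $(\mathcal{C},G,\varphi)$ in $B$ is a pair $(T,U)$ where $T\colon\mathcal{C}\to B$ is a nondegenerate representation and $U\colon G\to M(B)$ is a unitary representation such that $U_gT_\alpha=T_{g\alpha}U_{\varphi(g,\alpha)}$ for all $g\in G$, $\alpha\in\mathcal{C}$. The assignment $(T,U)\mapsto T\times U$, $(T\times U)_{(\alpha,g)}=T_\alpha U_g$, is a bijection onto the nondegenerate representations of $\mathcal{D}$ in $B$. *)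

theory Defs
  imports "HOL-Analysis.Analysis" "HOL-Algebra.Group_Action"
begin

section \<open>C*-algebras\<close>

class complex_normed_vector = real_normed_vector +
  fixes scaleC :: "complex \<Rightarrow> 'a \<Rightarrow> 'a"  (infixr "*\<^sub>C" 75)
  assumes scaleC_add_right: "c *\<^sub>C (x + y) = c *\<^sub>C x + c *\<^sub>C y"
    and scaleC_add_left: "(c + d) *\<^sub>C x = c *\<^sub>C x + d *\<^sub>C x"
    and scaleC_scaleC: "c *\<^sub>C (d *\<^sub>C x) = (c * d) *\<^sub>C x"
    and scaleC_of_real: "complex_of_real r *\<^sub>C x = r *\<^sub>R x"
    and norm_scaleC: "norm (c *\<^sub>C x) = cmod c * norm x"

class star =
  fixes star :: "'a \<Rightarrow> 'a"  ("_\<^sup>\<star>" [999] 999)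

text \<open>Not necessarily unital.\<close>

class cstar_algebra = complex_normed_vector + real_normed_algebra + complete_space + star +
  assumes scaleC_mult_left: "(c *\<^sub>C x) * y = c *\<^sub>C (x * y)"
    and scaleC_mult_right: "x * (c *\<^sub>C y) = c *\<^sub>C (x * y)"
    and star_add: "(x + y)\<^sup>\<star> = x\<^sup>\<star> + y\<^sup>\<star>"
    and star_scaleC: "(c *\<^sub>C x)\<^sup>\<star> = cnj c *\<^sub>C x\<^sup>\<star>"
    and star_mult: "(x * y)\<^sup>\<star> = y\<^sup>\<star> * x\<^sup>\<star>"
    and star_star [simp]: "x\<^sup>\<star>\<^sup>\<star> = x"
    and cstar_identity: "norm (x\<^sup>\<star> * x) = (norm x)\<^sup>2"

instantiation complex :: cstar_algebra
begin
definition scaleC_complex :: "complex \<Rightarrow> complex \<Rightarrow> complex" where "scaleC_complex = (*)"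
definition star_complex :: "complex \<Rightarrow> complex" where "star_complex = cnj"
instance
  by standard
    (auto simp: scaleC_complex_def star_complex_def algebra_simps norm_mult power2_eq_square
      scaleR_conv_of_real)
end

lemma norm_star: "norm (x\<^sup>\<star>) = norm (x :: 'a::cstar_algebra)"
proof -
  have le: "norm y \<le> norm (y\<^sup>\<star>)" for y :: 'a
  proof (cases "y = 0")
    case False
    have "norm y * norm y \<le> norm (y\<^sup>\<star>) * norm y"
      using cstar_identity[of y] norm_mult_ineq[of "y\<^sup>\<star>" y] by (simp add: power2_eq_square)
    with False show ?thesis by simp
  qed simp
  from le[of x] le[of "x\<^sup>\<star>"] show ?thesis by simp
qed

lemma star_scaleR: "(r *\<^sub>R x)\<^sup>\<star> = r *\<^sub>R (x\<^sup>\<star>)" for x :: "'a::cstar_algebra"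
  using star_scaleC[of "complex_of_real r" x] by (simp add: scaleC_of_real)

lemma bounded_linear_star: "bounded_linear (star :: 'a::cstar_algebra \<Rightarrow> 'a)"
  by (rule bounded_linear_intro[where K = 1]) (simp_all add: star_add star_scaleR norm_star)

section \<open>The bidual as an algebra\<close>

typedef (overloaded) ('a::complex_normed_vector) dual =
  "{f :: 'a \<Rightarrow>\<^sub>L complex. \<forall>c x. blinfun_apply f (c *\<^sub>C x) = c * blinfun_apply f x}"
  by (rule exI[of _ 0]) simp

setup_lifting type_definition_dual

instantiation dual :: (complex_normed_vector) complex_normed_vector
begin
lift_definition zero_dual :: "'a dual" is 0 by simp
lift_definition plus_dual :: "'a dual \<Rightarrow> 'a dual \<Rightarrow> 'a dual" is "(+)"
  by (simp add: blinfun.add_left algebra_simps)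
lift_definition minus_dual :: "'a dual \<Rightarrow> 'a dual \<Rightarrow> 'a dual" is "(-)"
  by (simp add: blinfun.diff_left algebra_simps)
lift_definition uminus_dual :: "'a dual \<Rightarrow> 'a dual" is uminus
  by (simp add: blinfun.minus_left)
lift_definition scaleR_dual :: "real \<Rightarrow> 'a dual \<Rightarrow> 'a dual" is scaleR
  by (simp add: blinfun.scaleR_left)
lift_definition scaleC_dual :: "complex \<Rightarrow> 'a dual \<Rightarrow> 'a dual"
  is "\<lambda>c f. blinfun_mult_right c o\<^sub>L f"
  by simp
lift_definition norm_dual :: "'a dual \<Rightarrow> real" is norm .
definition dist_dual :: "'a dual \<Rightarrow> 'a dual \<Rightarrow> real" where "dist_dual f g = norm (f - g)"
definition sgn_dual :: "'a dual \<Rightarrow> 'a dual" where "sgn_dual f = scaleR (inverse (norm f)) f"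
definition uniformity_dual :: "('a dual \<times> 'a dual) filter"
  where "uniformity_dual = (INF e\<in>{0<..}. principal {(x, y). dist x y < e})"
definition open_dual :: "'a dual set \<Rightarrow> bool"
  where "open_dual S \<longleftrightarrow> (\<forall>x\<in>S. \<forall>\<^sub>F (x', y) in uniformity. x' = x \<longrightarrow> y \<in> S)"

instance
proof
  fix f g h :: "'a dual" and a b r :: real and c d :: complex
  show "f + g + h = f + (g + h)" "f + g = g + f" "0 + f = f" "- f + f = 0" "f - g = f + - g"
    by (transfer, simp)+
  show "a *\<^sub>R (f + g) = a *\<^sub>R f + a *\<^sub>R g" "(a + b) *\<^sub>R f = a *\<^sub>R f + b *\<^sub>R f"
    "a *\<^sub>R b *\<^sub>R f = (a * b) *\<^sub>R f" "1 *\<^sub>R f = f"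
    by (transfer, simp add: algebra_simps)+
  show "sgn f = scaleR (inverse (norm f)) f" by (simp add: sgn_dual_def)
  show "dist f g = norm (f - g)" by (simp add: dist_dual_def)
  show "(uniformity :: ('a dual \<times> 'a dual) filter)
      = (INF e\<in>{0<..}. principal {(x, y). dist x y < e})"
    by (simp add: uniformity_dual_def)
  show "open S \<longleftrightarrow> (\<forall>x\<in>S. \<forall>\<^sub>F (x', y) in uniformity. x' = x \<longrightarrow> y \<in> S)" for S :: "'a dual set"
    by (simp add: open_dual_def)
  show "norm f = 0 \<longleftrightarrow> f = 0" by (transfer, simp)
  show "norm (f + g) \<le> norm f + norm g" by (transfer, rule norm_triangle_ineq)
  show "norm (a *\<^sub>R f) = \<bar>a\<bar> * norm f" by (transfer, simp)
  show "c *\<^sub>C (f + g) = c *\<^sub>C f + c *\<^sub>C g" "(c + d) *\<^sub>C f = c *\<^sub>C f + d *\<^sub>C f"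
    "c *\<^sub>C d *\<^sub>C f = (c * d) *\<^sub>C f" "complex_of_real r *\<^sub>C f = r *\<^sub>R f"
    by (transfer, rule blinfun_eqI,
        simp add: blinfun.add_left blinfun.add_right blinfun.scaleR_left algebra_simps
          scaleR_conv_of_real)+
  have le: "norm (blinfun_mult_right k o\<^sub>L F) \<le> cmod k * norm F" for k and F :: "'a \<Rightarrow>\<^sub>L complex"
  proof (rule norm_blinfun_bound)
    fix x
    show "norm (blinfun_apply (blinfun_mult_right k o\<^sub>L F) x) \<le> cmod k * norm F * norm x"
      using mult_left_mono[OF norm_blinfun[of F x], of "cmod k"]
      by (simp add: norm_mult mult.assoc)
  qed simp
  show "norm (c *\<^sub>C f) = cmod c * norm f"
  proof (transfer fixing: c, rule antisym[OF le])
    fix F :: "'a \<Rightarrow>\<^sub>L complex"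
    show "cmod c * norm F \<le> norm (blinfun_mult_right c o\<^sub>L F)"
    proof (cases "c = 0")
      case False
      have "F = blinfun_mult_right (inverse c) o\<^sub>L (blinfun_mult_right c o\<^sub>L F)"
        using False by (intro blinfun_eqI) simp
      then have "norm F \<le> cmod (inverse c) * norm (blinfun_mult_right c o\<^sub>L F)"
        using le[of "inverse c" "blinfun_mult_right c o\<^sub>L F"] by simp
      with False show ?thesis
        by (simp add: norm_divide field_simps)
    qed simp
  qed
qed
end

definition dual_apply :: "'a::complex_normed_vector dual \<Rightarrow> 'a \<Rightarrow> complex"
  where "dual_apply f = blinfun_apply (Rep_dual f)"

definition mk_dual :: "('a::complex_normed_vector \<Rightarrow> complex) \<Rightarrow> 'a dual"
  where "mk_dual f = Abs_dual (Blinfun f)"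

lemma dual_eqI: "(\<And>x. dual_apply f x = dual_apply g x) \<Longrightarrow> f = g"
  by (simp add: dual_apply_def Rep_dual_inject[symmetric] blinfun_eqI)

lemma dual_apply_mk_dual:
  assumes "bounded_linear f" and "\<And>c x. f (c *\<^sub>C x) = c * f x"
  shows "dual_apply (mk_dual f) = f"
  using assms by (simp add: dual_apply_def mk_dual_def Abs_dual_inverse bounded_linear_Blinfun_apply)

lemma dual_apply_scaleC_right: "dual_apply f (c *\<^sub>C x) = c * dual_apply f x"
  using Rep_dual[of f] by (simp add: dual_apply_def)

lemma dual_apply_add_left: "dual_apply (f + g) x = dual_apply f x + dual_apply g x"
  unfolding dual_apply_def by transfer (simp add: blinfun.add_left)

lemma dual_apply_scaleR_left: "dual_apply (r *\<^sub>R f) x = r *\<^sub>R dual_apply f x"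
  unfolding dual_apply_def by transfer (simp add: blinfun.scaleR_left)

lemma dual_apply_scaleC_left: "dual_apply (c *\<^sub>C f) x = c * dual_apply f x"
  unfolding dual_apply_def by transfer simp

lemma bounded_linear_dual_apply: "bounded_linear (dual_apply f)"
  unfolding dual_apply_def by (rule blinfun.bounded_linear_right)

lemmas dual_apply_add_right = linear_add[OF bounded_linear.linear[OF bounded_linear_dual_apply]]
lemmas dual_apply_scaleR_right = linear_scale[OF bounded_linear.linear[OF bounded_linear_dual_apply]]

lemma dual_apply_bound: "cmod (dual_apply f x) \<le> norm f * norm x"
  unfolding dual_apply_def by transfer (rule norm_blinfun)

lemma norm_dual_bound: "0 \<le> K \<Longrightarrow> (\<And>x. cmod (dual_apply f x) \<le> K * norm x) \<Longrightarrow> norm f \<le> K"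
  unfolding dual_apply_def by transfer (rule norm_blinfun_bound)

text \<open>
  The first Arens product on the bidual of \<open>B\<close> is defined in three steps: for
  \<open>f \<in> B*\<close>, \<open>a \<in> B\<close>, \<open>m, n \<in> B**\<close>, put \<open>(f\<cdot>a)(b) = f(ab)\<close>, \<open>(n\<cdot>f)(a) = n(f\<cdot>a)\<close> and
  \<open>(mn)(f) = m(n\<cdot>f)\<close>.  For a C*-algebra this product together with the involution
  \<open>m*(f) = cnj (m(f*))\<close>, \<open>f*(a) = cnj (f(a*))\<close>, is that of the enveloping von Neumann algebra
  (Sherman-Takeda).
\<close>

type_synonym 'a bidual = "'a dual dual"

definition dual_translate :: "'a::cstar_algebra dual \<Rightarrow> 'a \<Rightarrow> 'a dual"
  where "dual_translate f a = mk_dual (\<lambda>b. dual_apply f (a * b))"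

definition bidual_act :: "'a::cstar_algebra bidual \<Rightarrow> 'a dual \<Rightarrow> 'a dual"
  where "bidual_act n f = mk_dual (\<lambda>a. dual_apply n (dual_translate f a))"

definition bidual_mult :: "'a::cstar_algebra bidual \<Rightarrow> 'a bidual \<Rightarrow> 'a bidual"
  where "bidual_mult m n = mk_dual (\<lambda>f. dual_apply m (bidual_act n f))"

definition dual_star :: "'a::cstar_algebra dual \<Rightarrow> 'a dual"
  where "dual_star f = mk_dual (\<lambda>a. cnj (dual_apply f (a\<^sup>\<star>)))"

definition bidual_star :: "'a::cstar_algebra bidual \<Rightarrow> 'a bidual"
  where "bidual_star m = mk_dual (\<lambda>f. cnj (dual_apply m (dual_star f)))"

definition bidual_embed :: "'a::complex_normed_vector \<Rightarrow> 'a bidual"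
  where "bidual_embed a = mk_dual (\<lambda>f. dual_apply f a)"

lemma dual_apply_translate: "dual_apply (dual_translate f a) b = dual_apply f (a * b)"
proof -
  have "bounded_linear (\<lambda>b. dual_apply f (a * b))"
    by (rule bounded_linear_compose[OF bounded_linear_dual_apply bounded_linear_mult_right])
  then show ?thesis
    by (simp add: dual_translate_def dual_apply_mk_dual scaleC_mult_right dual_apply_scaleC_right)
qed

lemma dual_translate_add_right: "dual_translate f (a + b) = dual_translate f a + dual_translate f b"
  and dual_translate_scaleR_right: "dual_translate f (r *\<^sub>R a) = r *\<^sub>R dual_translate f a"
  and dual_translate_scaleC_right: "dual_translate f (c *\<^sub>C a) = c *\<^sub>C dual_translate f a"
  and dual_translate_add_left: "dual_translate (f + g) a = dual_translate f a + dual_translate g a"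
  and dual_translate_scaleR_left: "dual_translate (r *\<^sub>R f) a = r *\<^sub>R dual_translate f a"
  and dual_translate_scaleC_left: "dual_translate (c *\<^sub>C f) a = c *\<^sub>C dual_translate f a"
  by (rule dual_eqI, simp add: dual_apply_translate dual_apply_add_left dual_apply_scaleR_left
      dual_apply_scaleC_left dual_apply_add_right dual_apply_scaleR_right dual_apply_scaleC_right
      distrib_right scaleC_mult_left)+

lemma norm_dual_translate: "norm (dual_translate f a) \<le> norm f * norm a"
proof (rule norm_dual_bound)
  fix x
  have "cmod (dual_apply f (a * x)) \<le> norm f * (norm a * norm x)"
    by (rule order_trans[OF dual_apply_bound mult_left_mono[OF norm_mult_ineq]]) simp
  then show "cmod (dual_apply (dual_translate f a) x) \<le> norm f * norm a * norm x"
    by (simp add: dual_apply_translate mult.assoc)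
qed simp

lemma dual_apply_bidual_act: "dual_apply (bidual_act n f) a = dual_apply n (dual_translate f a)"
proof -
  have "bounded_linear (\<lambda>a. dual_apply n (dual_translate f a))"
  proof (rule bounded_linear_intro[where K = "norm n * norm f"])
    fix a
    have "cmod (dual_apply n (dual_translate f a)) \<le> norm n * (norm f * norm a)"
      by (rule order_trans[OF dual_apply_bound mult_left_mono[OF norm_dual_translate]]) simp
    then show "norm (dual_apply n (dual_translate f a)) \<le> norm a * (norm n * norm f)"
      by (simp add: mult_ac)
  qed (simp_all add: dual_translate_add_right dual_translate_scaleR_right dual_apply_add_right
      dual_apply_scaleR_right)
  then show ?thesis
    by (simp add: bidual_act_def dual_apply_mk_dual dual_translate_scaleC_right
        dual_apply_scaleC_right)
qed

lemma bidual_act_add: "bidual_act n (f + g) = bidual_act n f + bidual_act n g"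
  and bidual_act_scaleR: "bidual_act n (r *\<^sub>R f) = r *\<^sub>R bidual_act n f"
  and bidual_act_scaleC: "bidual_act n (c *\<^sub>C f) = c *\<^sub>C bidual_act n f"
  by (rule dual_eqI, simp add: dual_apply_bidual_act dual_translate_add_left
      dual_translate_scaleR_left dual_translate_scaleC_left dual_apply_add_left
      dual_apply_scaleR_left dual_apply_scaleC_left dual_apply_add_right dual_apply_scaleR_right
      dual_apply_scaleC_right)+

lemma norm_bidual_act: "norm (bidual_act n f) \<le> norm n * norm f"
proof (rule norm_dual_bound)
  fix a
  have "cmod (dual_apply n (dual_translate f a)) \<le> norm n * (norm f * norm a)"
    by (rule order_trans[OF dual_apply_bound mult_left_mono[OF norm_dual_translate]]) simp
  then show "cmod (dual_apply (bidual_act n f) a) \<le> norm n * norm f * norm a"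
    by (simp add: dual_apply_bidual_act mult.assoc)
qed simp

lemma dual_apply_bidual_mult: "dual_apply (bidual_mult m n) f = dual_apply m (bidual_act n f)"
proof -
  have "bounded_linear (\<lambda>f. dual_apply m (bidual_act n f))"
  proof (rule bounded_linear_intro[where K = "norm m * norm n"])
    fix f
    have "cmod (dual_apply m (bidual_act n f)) \<le> norm m * (norm n * norm f)"
      by (rule order_trans[OF dual_apply_bound mult_left_mono[OF norm_bidual_act]]) simp
    then show "norm (dual_apply m (bidual_act n f)) \<le> norm f * (norm m * norm n)"
      by (simp add: mult_ac)
  qed (simp_all add: bidual_act_add bidual_act_scaleR dual_apply_add_right dual_apply_scaleR_right)
  then show ?thesis
    by (simp add: bidual_mult_def dual_apply_mk_dual bidual_act_scaleC dual_apply_scaleC_right)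
qed

lemma dual_apply_dual_star: "dual_apply (dual_star f) a = cnj (dual_apply f (a\<^sup>\<star>))"
proof -
  have "bounded_linear (\<lambda>a. cnj (dual_apply f (a\<^sup>\<star>)))"
    by (intro bounded_linear_compose[OF bounded_linear_cnj]
        bounded_linear_compose[OF bounded_linear_dual_apply] bounded_linear_star)
  then show ?thesis
    by (simp add: dual_star_def dual_apply_mk_dual star_scaleC dual_apply_scaleC_right)
qed

lemma dual_star_add: "dual_star (f + g) = dual_star f + dual_star g"
  and dual_star_scaleR: "dual_star (r *\<^sub>R f) = r *\<^sub>R dual_star f"
  and dual_star_scaleC: "dual_star (c *\<^sub>C f) = cnj c *\<^sub>C dual_star f"
  by (rule dual_eqI, simp add: dual_apply_dual_star dual_apply_add_left dual_apply_scaleR_left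
      dual_apply_scaleC_left)+

lemma norm_dual_star: "norm (dual_star f) \<le> norm f"
proof (rule norm_dual_bound)
  fix a
  show "cmod (dual_apply (dual_star f) a) \<le> norm f * norm a"
    using dual_apply_bound[of f "a\<^sup>\<star>"] by (simp add: dual_apply_dual_star norm_star)
qed simp

lemma dual_apply_bidual_star: "dual_apply (bidual_star m) f = cnj (dual_apply m (dual_star f))"
proof -
  have "bounded_linear (\<lambda>f. cnj (dual_apply m (dual_star f)))"
  proof (rule bounded_linear_intro[where K = "norm m"])
    fix f
    have "cmod (dual_apply m (dual_star f)) \<le> norm m * norm f"
      by (rule order_trans[OF dual_apply_bound mult_left_mono[OF norm_dual_star]]) simp
    then show "norm (cnj (dual_apply m (dual_star f))) \<le> norm f * norm m"
      by (simp add: mult_ac)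
  qed (simp_all add: dual_star_add dual_star_scaleR dual_apply_add_right dual_apply_scaleR_right)
  then show ?thesis
    by (simp add: bidual_star_def dual_apply_mk_dual dual_star_scaleC dual_apply_scaleC_right)
qed

lemma dual_apply_bidual_embed: "dual_apply (bidual_embed a) f = dual_apply f a"
proof -
  have "bounded_linear (\<lambda>f. dual_apply f a)"
    by (rule bounded_linear_intro[where K = "norm a"])
      (simp_all add: dual_apply_add_left dual_apply_scaleR_left dual_apply_bound)
  then show ?thesis
    by (simp add: bidual_embed_def dual_apply_mk_dual dual_apply_scaleC_left)
qed

lemma bidual_embed_mult: "bidual_embed (a * b) = bidual_mult (bidual_embed a) (bidual_embed b)"
  by (rule dual_eqI)
    (simp add: dual_apply_bidual_embed dual_apply_bidual_mult dual_apply_bidual_act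
      dual_apply_translate)

lemma bidual_embed_star: "bidual_embed (a\<^sup>\<star>) = bidual_star (bidual_embed a)"
  by (rule dual_eqI)
    (simp add: dual_apply_bidual_embed dual_apply_bidual_star dual_apply_dual_star)

section \<open>Joins of projections\<close>

definition bidual_projections :: "'a::cstar_algebra bidual set"
  where "bidual_projections = {p. bidual_mult p p = p \<and> bidual_star p = p}"

definition proj_le :: "'a::cstar_algebra bidual \<Rightarrow> 'a bidual \<Rightarrow> bool"
  where "proj_le p q \<longleftrightarrow> bidual_mult p q = p"

definition is_proj_join :: "'a::cstar_algebra bidual set \<Rightarrow> 'a bidual \<Rightarrow> bool"
  where "is_proj_join P p \<longleftrightarrow>
    P \<subseteq> bidual_projections \<and> p \<in> bidual_projections \<and> (\<forall>q\<in>P. proj_le q p) \<and>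
    (\<forall>q\<in>bidual_projections. (\<forall>q'\<in>P. proj_le q' q) \<longrightarrow> proj_le p q)"

text \<open>The element \<open>b\<close> of \<open>B\<close> is the join, formed in \<open>B**\<close>, of the projections in \<open>P \<subseteq> B\<close>.\<close>

definition is_join_of :: "'a::cstar_algebra \<Rightarrow> 'a set \<Rightarrow> bool"
  where "is_join_of b P \<longleftrightarrow> is_proj_join (bidual_embed ` P) (bidual_embed b)"

section \<open>The multiplier algebra\<close>

definition complex_bounded_linear :: "('a::complex_normed_vector \<Rightarrow> 'a) \<Rightarrow> bool"
  where "complex_bounded_linear f \<longleftrightarrow> bounded_linear f \<and> (\<forall>c x. f (c *\<^sub>C x) = c *\<^sub>C f x)"

text \<open>
  Multipliers are double centralizers \<open>(L, R)\<close>: \<open>L\<close> is left and \<open>R\<close> is right multiplication by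
  the multiplier.
\<close>

typedef (overloaded) ('a::cstar_algebra) multiplier =
  "{LR :: ('a \<Rightarrow> 'a) \<times> ('a \<Rightarrow> 'a). case LR of (L, R) \<Rightarrow>
      complex_bounded_linear L \<and> complex_bounded_linear R \<and>
      (\<forall>a b. L (a * b) = L a * b) \<and> (\<forall>a b. R (a * b) = a * R b) \<and>
      (\<forall>a b. R a * b = a * L b)}"
  by (rule exI[of _ "(id, id)"]) (simp add: complex_bounded_linear_def id_def)

setup_lifting type_definition_multiplier

lemma complex_bounded_linear_comp:
  "complex_bounded_linear f \<Longrightarrow> complex_bounded_linear g \<Longrightarrow> complex_bounded_linear (f \<circ> g)"
  by (simp add: complex_bounded_linear_def bounded_linear_compose comp_def)

lemma complex_bounded_linear_star:
  fixes f :: "'a::cstar_algebra \<Rightarrow> 'a"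
  assumes "complex_bounded_linear f"
  shows "complex_bounded_linear (\<lambda>x. (f (x\<^sup>\<star>))\<^sup>\<star>)"
proof -
  have "bounded_linear (\<lambda>x. (f (x\<^sup>\<star>))\<^sup>\<star>)"
    using assms bounded_linear_compose[OF bounded_linear_star
        bounded_linear_compose[OF _ bounded_linear_star]]
    unfolding complex_bounded_linear_def by blast
  with assms show ?thesis by (simp add: complex_bounded_linear_def star_scaleC)
qed

instantiation multiplier :: (cstar_algebra) "{monoid_mult, star}"
begin
lift_definition one_multiplier :: "'a multiplier" is "(id, id)"
  by (simp add: complex_bounded_linear_def id_def)
lift_definition times_multiplier :: "'a multiplier \<Rightarrow> 'a multiplier \<Rightarrow> 'a multiplier"
  is "\<lambda>(L, R) (L', R'). (L \<circ> L', R' \<circ> R)"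
  by (auto simp: complex_bounded_linear_comp)
lift_definition star_multiplier :: "'a multiplier \<Rightarrow> 'a multiplier"
  is "\<lambda>(L, R). (\<lambda>a. (R (a\<^sup>\<star>))\<^sup>\<star>, \<lambda>a. (L (a\<^sup>\<star>))\<^sup>\<star>)"
proof (clarsimp simp: complex_bounded_linear_star star_mult)
  fix L R :: "'a \<Rightarrow> 'a" and a b
  assume *: "\<forall>a b. R a * b = a * L b"
  have "((L (a\<^sup>\<star>))\<^sup>\<star> * b)\<^sup>\<star> = (a * (R (b\<^sup>\<star>))\<^sup>\<star>)\<^sup>\<star>"
    by (simp add: star_mult *)
  then show "(L (a\<^sup>\<star>))\<^sup>\<star> * b = a * (R (b\<^sup>\<star>))\<^sup>\<star>"
    by (metis star_star)
qed
instance
  by standard (transfer, auto simp: fun_eq_iff)+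
end

lift_definition lmult :: "'a::cstar_algebra multiplier \<Rightarrow> 'a \<Rightarrow> 'a" is fst .
lift_definition rmult :: "'a::cstar_algebra \<Rightarrow> 'a multiplier \<Rightarrow> 'a" is "\<lambda>b m. snd m b" .

lift_definition to_multiplier :: "'a::cstar_algebra \<Rightarrow> 'a multiplier"
  is "\<lambda>a. (\<lambda>b. a * b, \<lambda>b. b * a)"
  by (simp add: complex_bounded_linear_def bounded_linear_mult_right bounded_linear_mult_left
      scaleC_mult_left scaleC_mult_right mult.assoc)

lemma to_multiplier_mult: "to_multiplier (a * b) = to_multiplier a * to_multiplier b"
  by transfer (simp add: fun_eq_iff mult.assoc)

lemma to_multiplier_star: "to_multiplier (a\<^sup>\<star>) = (to_multiplier a)\<^sup>\<star>"
  by transfer (simp add: fun_eq_iff star_mult)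

lemma to_multiplier_lmult: "to_multiplier (lmult m b) = m * to_multiplier b"
  by transfer (auto simp: fun_eq_iff)

lemma to_multiplier_rmult: "to_multiplier (rmult b m) = to_multiplier b * m"
  by transfer (auto simp: fun_eq_iff)

definition strict_tendsto :: "('i \<Rightarrow> 'a::cstar_algebra multiplier) \<Rightarrow> 'a multiplier \<Rightarrow> 'i filter \<Rightarrow> bool"
  where "strict_tendsto m l F \<longleftrightarrow>
    (\<forall>b. ((\<lambda>i. lmult (m i) b) \<longlongrightarrow> lmult l b) F \<and> ((\<lambda>i. rmult b (m i)) \<longlongrightarrow> rmult b l) F)"

section \<open>Small categories\<close>

text \<open>
  A category is its set of morphisms; vertices are the identity morphisms, and
  \<open>\<alpha> \<cdot> \<beta>\<close> is meaningful when the source of \<open>\<alpha>\<close> is the range of \<open>\<beta>\<close>.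
\<close>

record 'c smallcat =
  Mor :: "'c set"
  Vert :: "'c set"
  rge :: "'c \<Rightarrow> 'c"
  src :: "'c \<Rightarrow> 'c"
  mcomp :: "'c \<Rightarrow> 'c \<Rightarrow> 'c"

locale small_category =
  fixes C :: "'c smallcat"
  assumes vert_sub: "Vert C \<subseteq> Mor C" and vert_nonempty: "Vert C \<noteq> {}"
    and rge_vert: "\<alpha> \<in> Mor C \<Longrightarrow> rge C \<alpha> \<in> Vert C"
    and src_vert: "\<alpha> \<in> Mor C \<Longrightarrow> src C \<alpha> \<in> Vert C"
    and rge_id: "v \<in> Vert C \<Longrightarrow> rge C v = v"
    and src_id: "v \<in> Vert C \<Longrightarrow> src C v = v"
    and comp_mor: "\<lbrakk>\<alpha> \<in> Mor C; \<beta> \<in> Mor C; src C \<alpha> = rge C \<beta>\<rbrakk> \<Longrightarrow> mcomp C \<alpha> \<beta> \<in> Mor C"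
    and rge_comp: "\<lbrakk>\<alpha> \<in> Mor C; \<beta> \<in> Mor C; src C \<alpha> = rge C \<beta>\<rbrakk> \<Longrightarrow> rge C (mcomp C \<alpha> \<beta>) = rge C \<alpha>"
    and src_comp: "\<lbrakk>\<alpha> \<in> Mor C; \<beta> \<in> Mor C; src C \<alpha> = rge C \<beta>\<rbrakk> \<Longrightarrow> src C (mcomp C \<alpha> \<beta>) = src C \<beta>"
    and comp_assoc: "\<lbrakk>\<alpha> \<in> Mor C; \<beta> \<in> Mor C; \<gamma> \<in> Mor C; src C \<alpha> = rge C \<beta>; src C \<beta> = rge C \<gamma>\<rbrakk>
      \<Longrightarrow> mcomp C (mcomp C \<alpha> \<beta>) \<gamma> = mcomp C \<alpha> (mcomp C \<beta> \<gamma>)"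
    and id_left: "\<alpha> \<in> Mor C \<Longrightarrow> mcomp C (rge C \<alpha>) \<alpha> = \<alpha>"
    and id_right: "\<alpha> \<in> Mor C \<Longrightarrow> mcomp C \<alpha> (src C \<alpha>) = \<alpha>"

definition right_ideal :: "'c smallcat \<Rightarrow> 'c \<Rightarrow> 'c set"
  where "right_ideal C \<alpha> = {mcomp C \<alpha> \<beta> | \<beta>. \<beta> \<in> Mor C \<and> rge C \<beta> = src C \<alpha>}"

definition finitely_aligned :: "'c smallcat \<Rightarrow> bool"
  where "finitely_aligned C \<longleftrightarrow> (\<forall>\<alpha>\<in>Mor C. \<forall>\<beta>\<in>Mor C. \<exists>F. finite F \<and> F \<subseteq> Mor C \<and>
    right_ideal C \<alpha> \<inter> right_ideal C \<beta> = (\<Union>\<gamma>\<in>F. right_ideal C \<gamma>))"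

locale finitely_aligned_lcsc = small_category +
  assumes left_cancel: "\<lbrakk>\<alpha> \<in> Mor C; \<beta> \<in> Mor C; \<gamma> \<in> Mor C; src C \<alpha> = rge C \<beta>; src C \<alpha> = rge C \<gamma>;
      mcomp C \<alpha> \<beta> = mcomp C \<alpha> \<gamma>\<rbrakk> \<Longrightarrow> \<beta> = \<gamma>"
    and fin_aligned: "finitely_aligned C"

definition independent_mor :: "'c smallcat \<Rightarrow> 'c set \<Rightarrow> bool"
  where "independent_mor C F \<longleftrightarrow> (\<forall>\<gamma>\<in>F. \<forall>\<gamma>'\<in>F. \<gamma> \<noteq> \<gamma>' \<longrightarrow> \<gamma> \<notin> right_ideal C \<gamma>')"

text \<open>The set \<open>F\<close> is one of the possible choices for \<open>\<alpha> \<or> \<beta>\<close>.\<close>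

definition is_vee :: "'c smallcat \<Rightarrow> 'c \<Rightarrow> 'c \<Rightarrow> 'c set \<Rightarrow> bool"
  where "is_vee C \<alpha> \<beta> F \<longleftrightarrow> finite F \<and> F \<subseteq> Mor C \<and> independent_mor C F \<and>
    right_ideal C \<alpha> \<inter> right_ideal C \<beta> = (\<Union>\<gamma>\<in>F. right_ideal C \<gamma>)"

definition exhaustive_at :: "'c smallcat \<Rightarrow> 'c \<Rightarrow> 'c set \<Rightarrow> bool"
  where "exhaustive_at C v F \<longleftrightarrow> F \<subseteq> {\<alpha> \<in> Mor C. rge C \<alpha> = v} \<and>
    (\<forall>\<alpha>\<in>Mor C. rge C \<alpha> = v \<longrightarrow> (\<exists>\<beta>\<in>F. right_ideal C \<alpha> \<inter> right_ideal C \<beta> \<noteq> {}))"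

context small_category
begin

lemma self_in_right_ideal:
  assumes "\<alpha> \<in> Mor C"
  shows "\<alpha> \<in> right_ideal C \<alpha>"
proof -
  have "src C \<alpha> \<in> Mor C" "rge C (src C \<alpha>) = src C \<alpha>" "\<alpha> = mcomp C \<alpha> (src C \<alpha>)"
    using src_vert[OF assms] vert_sub rge_id[of "src C \<alpha>"] id_right[OF assms] by auto
  then show ?thesis unfolding right_ideal_def by blast
qed

lemma right_ideal_sub: "\<alpha> \<in> Mor C \<Longrightarrow> right_ideal C \<alpha> \<subseteq> Mor C"
  unfolding right_ideal_def using comp_mor by auto

lemma right_ideal_mono:
  assumes "\<alpha> \<in> Mor C" "\<beta> \<in> right_ideal C \<alpha>"
  shows "right_ideal C \<beta> \<subseteq> right_ideal C \<alpha>"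
proof
  fix x assume "x \<in> right_ideal C \<beta>"
  then obtain \<delta> where \<delta>: "\<delta> \<in> Mor C" "rge C \<delta> = src C \<beta>" "x = mcomp C \<beta> \<delta>"
    by (auto simp: right_ideal_def)
  obtain \<gamma> where \<gamma>: "\<gamma> \<in> Mor C" "rge C \<gamma> = src C \<alpha>" "\<beta> = mcomp C \<alpha> \<gamma>"
    using assms(2) by (auto simp: right_ideal_def)
  have c: "src C \<alpha> = rge C \<gamma>" "src C \<gamma> = rge C \<delta>"
    using \<gamma> \<delta>(2) src_comp[OF assms(1) \<gamma>(1)] by simp_all
  have "x = mcomp C \<alpha> (mcomp C \<gamma> \<delta>)"
    using comp_assoc[OF assms(1) \<gamma>(1) \<delta>(1) c] \<gamma>(3) \<delta>(3) by simp
  moreover have "mcomp C \<gamma> \<delta> \<in> Mor C" by (rule comp_mor[OF \<gamma>(1) \<delta>(1) c(2)])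
  moreover have "rge C (mcomp C \<gamma> \<delta>) = src C \<alpha>"
    using rge_comp[OF \<gamma>(1) \<delta>(1) c(2)] \<gamma>(2) by simp
  ultimately show "x \<in> right_ideal C \<alpha>" unfolding right_ideal_def by blast
qed

end

lemma (in finitely_aligned_lcsc) vee_exists:
  assumes "\<alpha> \<in> Mor C" "\<beta> \<in> Mor C"
  shows "\<exists>F. is_vee C \<alpha> \<beta> F"
proof -
  define P where "P F \<longleftrightarrow> finite F \<and> F \<subseteq> Mor C \<and>
    right_ideal C \<alpha> \<inter> right_ideal C \<beta> = (\<Union>\<gamma>\<in>F. right_ideal C \<gamma>)" for F
  have "\<exists>F. P F"
    using bspec[OF bspec[OF fin_aligned[unfolded finitely_aligned_def] assms(1)] assms(2)]
    by (simp only: P_def)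
  then obtain F0 where "P F0" ..
  from ex_has_least_nat[where P = P and m = card, OF this]
  obtain F where PF: "P F" and min: "\<And>F'. P F' \<Longrightarrow> card F \<le> card F'"
    by blast
  then have F: "finite F" "F \<subseteq> Mor C"
    "right_ideal C \<alpha> \<inter> right_ideal C \<beta> = (\<Union>\<gamma>\<in>F. right_ideal C \<gamma>)"
    by (simp_all only: P_def)
  have "independent_mor C F"
    unfolding independent_mor_def
  proof (intro ballI impI notI)
    fix \<gamma> \<gamma>' assume *: "\<gamma> \<in> F" "\<gamma>' \<in> F" "\<gamma> \<noteq> \<gamma>'" "\<gamma> \<in> right_ideal C \<gamma>'"
    have "right_ideal C \<gamma> \<subseteq> right_ideal C \<gamma>'"
      using F(2) * by (intro right_ideal_mono) auto
    then have "(\<Union>\<delta>\<in>F. right_ideal C \<delta>) = (\<Union>\<delta>\<in>F - {\<gamma>}. right_ideal C \<delta>)"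
      using *(1-3) by blast
    then have "P (F - {\<gamma>})"
      unfolding P_def F(3) using F(1,2) by (intro conjI) auto
    then have "card F \<le> card (F - {\<gamma>})" by (rule min)
    moreover have "card (F - {\<gamma>}) < card F" using F(1) *(1) by (rule card_Diff1_less)
    ultimately show False by simp
  qed
  with F have "is_vee C \<alpha> \<beta> F" by (simp only: is_vee_def simp_thms)
  then show ?thesis ..
qed

section \<open>Representations of categories\<close>

text \<open>
  The join in the third condition does not depend on the choice of \<open>\<alpha> \<or> \<beta>\<close>, whence the
  quantification over all choices; by \<open>vee_exists\<close> there is at least one.
\<close>

definition cat_representation :: "'c smallcat \<Rightarrow> ('c \<Rightarrow> 'b::cstar_algebra) \<Rightarrow> bool"
  where "cat_representation C T \<longleftrightarrow>
    (\<forall>\<alpha>\<in>Mor C. (T \<alpha>)\<^sup>\<star> * T \<alpha> = T (src C \<alpha>)) \<and>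
    (\<forall>\<alpha>\<in>Mor C. \<forall>\<beta>\<in>Mor C. src C \<alpha> = rge C \<beta> \<longrightarrow> T \<alpha> * T \<beta> = T (mcomp C \<alpha> \<beta>)) \<and>
    (\<forall>\<alpha>\<in>Mor C. \<forall>\<beta>\<in>Mor C. \<forall>F. is_vee C \<alpha> \<beta> F \<longrightarrow>
      is_join_of (T \<alpha> * (T \<alpha>)\<^sup>\<star> * (T \<beta> * (T \<beta>)\<^sup>\<star>)) ((\<lambda>\<gamma>. T \<gamma> * (T \<gamma>)\<^sup>\<star>) ` F))"

definition covariant_representation :: "'c smallcat \<Rightarrow> ('c \<Rightarrow> 'b::cstar_algebra) \<Rightarrow> bool"
  where "covariant_representation C T \<longleftrightarrow> cat_representation C T \<and>
    (\<forall>v\<in>Vert C. \<forall>F. finite F \<and> exhaustive_at C v F \<longrightarrow>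
      is_join_of (T v) ((\<lambda>\<alpha>. T \<alpha> * (T \<alpha>)\<^sup>\<star>) ` F))"

definition nondegenerate :: "'c smallcat \<Rightarrow> ('c \<Rightarrow> 'b::cstar_algebra) \<Rightarrow> bool"
  where "nondegenerate C T \<longleftrightarrow>
    strict_tendsto (\<lambda>V. to_multiplier (\<Sum>v\<in>V. T v)) 1 (finite_subsets_at_top (Vert C))"

section \<open>Category systems\<close>

text \<open>
  The action is by bijections of the set of morphisms and need not be by functors.  As usual for
  \<open>group_action\<close>, \<open>act g\<close> is \<open>undefined\<close> outside the set of morphisms.
\<close>

locale category_system = small_category C + group_action G "Mor C" act
  for C :: "'c smallcat" and G :: "('g, 'm) monoid_scheme" (structure)
    and act :: "'g \<Rightarrow> 'c \<Rightarrow> 'c" +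
  fixes \<phi> :: "'g \<Rightarrow> 'c \<Rightarrow> 'g"
  assumes act_rge: "\<lbrakk>g \<in> carrier G; \<alpha> \<in> Mor C\<rbrakk> \<Longrightarrow> rge C (act g \<alpha>) = act g (rge C \<alpha>)"
    and act_src: "\<lbrakk>g \<in> carrier G; \<alpha> \<in> Mor C\<rbrakk> \<Longrightarrow> src C (act g \<alpha>) = act g (src C \<alpha>)"
    and cocycle_closed: "\<lbrakk>g \<in> carrier G; \<alpha> \<in> Mor C\<rbrakk> \<Longrightarrow> \<phi> g \<alpha> \<in> carrier G"
    and cocycle_mult: "\<lbrakk>g \<in> carrier G; h \<in> carrier G; \<alpha> \<in> Mor C\<rbrakk>
      \<Longrightarrow> \<phi> (g \<otimes> h) \<alpha> = \<phi> g (act h \<alpha>) \<otimes> \<phi> h \<alpha>"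
    and cocycle_vert: "\<lbrakk>g \<in> carrier G; v \<in> Vert C\<rbrakk> \<Longrightarrow> \<phi> g v = g"
    and cocycle_src: "\<lbrakk>g \<in> carrier G; \<alpha> \<in> Mor C\<rbrakk> \<Longrightarrow> act (\<phi> g \<alpha>) (src C \<alpha>) = act g (src C \<alpha>)"
    and act_comp: "\<lbrakk>g \<in> carrier G; \<alpha> \<in> Mor C; \<beta> \<in> Mor C; src C \<alpha> = rge C \<beta>\<rbrakk>
      \<Longrightarrow> act g (mcomp C \<alpha> \<beta>) = mcomp C (act g \<alpha>) (act (\<phi> g \<alpha>) \<beta>)"
    and cocycle_comp: "\<lbrakk>g \<in> carrier G; \<alpha> \<in> Mor C; \<beta> \<in> Mor C; src C \<alpha> = rge C \<beta>\<rbrakk>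
      \<Longrightarrow> \<phi> g (mcomp C \<alpha> \<beta>) = \<phi> (\<phi> g \<alpha>) \<beta>"

definition zappa_szep ::
    "'c smallcat \<Rightarrow> ('g, 'm) monoid_scheme \<Rightarrow> ('g \<Rightarrow> 'c \<Rightarrow> 'c) \<Rightarrow> ('g \<Rightarrow> 'c \<Rightarrow> 'g) \<Rightarrow> ('c \<times> 'g) smallcat"
  where "zappa_szep C G act \<phi> =
    \<lparr>Mor = Mor C \<times> carrier G,
     Vert = Vert C \<times> {\<one>\<^bsub>G\<^esub>},
     rge = (\<lambda>(\<alpha>, g). (rge C \<alpha>, \<one>\<^bsub>G\<^esub>)),
     src = (\<lambda>(\<alpha>, g). (act (inv\<^bsub>G\<^esub> g) (src C \<alpha>), \<one>\<^bsub>G\<^esub>)),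
     mcomp = (\<lambda>(\<alpha>, g) (\<beta>, h). (mcomp C \<alpha> (act g \<beta>), \<phi> g \<beta> \<otimes>\<^bsub>G\<^esub> h))\<rparr>"

context category_system
begin

interpretation group_G: group G
  using group_hom by (simp add: group_hom_def)

lemma act_closed: "\<lbrakk>g \<in> carrier G; \<alpha> \<in> Mor C\<rbrakk> \<Longrightarrow> act g \<alpha> \<in> Mor C"
  using element_image by blast

lemma act_vert: "\<lbrakk>g \<in> carrier G; v \<in> Vert C\<rbrakk> \<Longrightarrow> act g v \<in> Vert C"
  using act_rge[of g v] rge_id[of v] vert_sub act_closed rge_vert by (metis subsetD)

lemma act_one: "\<alpha> \<in> Mor C \<Longrightarrow> act \<one> \<alpha> = \<alpha>"
  using id_eq_one by (metis restrict_apply')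

lemma act_mult: "\<lbrakk>g \<in> carrier G; h \<in> carrier G; \<alpha> \<in> Mor C\<rbrakk> \<Longrightarrow> act (g \<otimes> h) \<alpha> = act g (act h \<alpha>)"
  by (rule composition_rule)

lemma act_inv: "\<lbrakk>g \<in> carrier G; \<alpha> \<in> Mor C\<rbrakk> \<Longrightarrow> act (inv g) (act g \<alpha>) = \<alpha>"
  and act_inv': "\<lbrakk>g \<in> carrier G; \<alpha> \<in> Mor C\<rbrakk> \<Longrightarrow> act g (act (inv g) \<alpha>) = \<alpha>"
  by (simp_all add: act_mult[symmetric] act_one)

lemma cocycle_one: "\<alpha> \<in> Mor C \<Longrightarrow> \<phi> \<one> \<alpha> = \<one>"
  using cocycle_mult[of \<one> \<one> \<alpha>] cocycle_closed[of \<one> \<alpha>] by (simp add: act_one)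

lemma zs_composable_iff:
  assumes "\<alpha> \<in> Mor C" "g \<in> carrier G" "\<beta> \<in> Mor C"
  shows "act (inv g) (src C \<alpha>) = rge C \<beta> \<longleftrightarrow> src C \<alpha> = rge C (act g \<beta>)"
proof -
  have "src C \<alpha> \<in> Mor C" "rge C \<beta> \<in> Mor C"
    using assms src_vert rge_vert vert_sub by auto
  then show ?thesis
    using assms act_inv act_inv' act_rge by metis
qed

lemma small_category_zappa_szep: "small_category (zappa_szep C G act \<phi>)" (is "small_category ?D")
proof
  have sel: "Mor ?D = Mor C \<times> carrier G" "Vert ?D = Vert C \<times> {\<one>}"
    "rge ?D (\<alpha>, g) = (rge C \<alpha>, \<one>)" "src ?D (\<alpha>, g) = (act (inv g) (src C \<alpha>), \<one>)"
    "mcomp ?D (\<alpha>, g) (\<beta>, h) = (mcomp C \<alpha> (act g \<beta>), \<phi> g \<beta> \<otimes> h)" for \<alpha> \<beta> g h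
    by (simp_all add: zappa_szep_def)
  show "Vert ?D \<subseteq> Mor ?D" "Vert ?D \<noteq> {}"
    using vert_sub vert_nonempty by (auto simp: sel)
  have vm: "v \<in> Vert C \<Longrightarrow> v \<in> Mor C" for v using vert_sub by blast
  show "rge ?D a \<in> Vert ?D" "src ?D a \<in> Vert ?D" if "a \<in> Mor ?D" for a
    using that by (auto simp: sel rge_vert src_vert act_vert)
  show "rge ?D v = v" "src ?D v = v" if "v \<in> Vert ?D" for v
    using that by (auto simp: sel rge_id src_id act_one vm)
  have comp: "mcomp ?D a b \<in> Mor ?D \<and> rge ?D (mcomp ?D a b) = rge ?D a \<and>
      src ?D (mcomp ?D a b) = src ?D b"
    if ab: "a \<in> Mor ?D" "b \<in> Mor ?D" "src ?D a = rge ?D b" for a b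
  proof -
    obtain \<alpha> g \<beta> h where [simp]: "a = (\<alpha>, g)" "b = (\<beta>, h)" by (cases a, cases b) blast
    have m [simp]: "\<alpha> \<in> Mor C" "g \<in> carrier G" "\<beta> \<in> Mor C" "h \<in> carrier G"
      using ab by (auto simp: sel)
    have c: "src C \<alpha> = rge C (act g \<beta>)"
      using ab(3) zs_composable_iff[of \<alpha> g \<beta>] by (simp add: sel)
    have s: "src C \<beta> \<in> Mor C" by (simp add: src_vert vm)
    have "act (inv (\<phi> g \<beta> \<otimes> h)) (src C (mcomp C \<alpha> (act g \<beta>)))
        = act (inv h) (act (inv (\<phi> g \<beta>)) (act (\<phi> g \<beta>) (src C \<beta>)))"
      using c s by (simp add: src_comp act_closed act_src cocycle_src cocycle_closed
          group_G.inv_mult_group act_mult)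
    also have "\<dots> = act (inv h) (src C \<beta>)"
      using s by (simp add: act_inv cocycle_closed)
    finally show ?thesis
      using c by (simp add: sel comp_mor act_closed cocycle_closed rge_comp)
  qed
  show "mcomp ?D a b \<in> Mor ?D" "rge ?D (mcomp ?D a b) = rge ?D a" "src ?D (mcomp ?D a b) = src ?D b"
    if "a \<in> Mor ?D" "b \<in> Mor ?D" "src ?D a = rge ?D b" for a b
    using comp[OF that] by auto
  show "mcomp ?D (mcomp ?D a b) c = mcomp ?D a (mcomp ?D b c)"
    if abc: "a \<in> Mor ?D" "b \<in> Mor ?D" "c \<in> Mor ?D" "src ?D a = rge ?D b" "src ?D b = rge ?D c"
    for a b c
  proof -
    obtain \<alpha> g \<beta> h \<gamma> k where [simp]: "a = (\<alpha>, g)" "b = (\<beta>, h)" "c = (\<gamma>, k)"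
      by (cases a, cases b, cases c) blast
    have m [simp]: "\<alpha> \<in> Mor C" "g \<in> carrier G" "\<beta> \<in> Mor C" "h \<in> carrier G"
      "\<gamma> \<in> Mor C" "k \<in> carrier G"
      using abc by (auto simp: sel)
    have c1: "src C \<alpha> = rge C (act g \<beta>)"
      using abc(4) zs_composable_iff[of \<alpha> g \<beta>] by (simp add: sel)
    have c2: "src C \<beta> = rge C (act h \<gamma>)"
      using abc(5) zs_composable_iff[of \<beta> h \<gamma>] by (simp add: sel)
    have c3: "src C (act g \<beta>) = rge C (act (\<phi> g \<beta>) (act h \<gamma>))"
      using c2 cocycle_src[OF m(2,3)] by (simp add: act_src act_rge act_closed cocycle_closed)
    have "mcomp C (mcomp C \<alpha> (act g \<beta>)) (act (\<phi> g \<beta> \<otimes> h) \<gamma>)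
        = mcomp C \<alpha> (mcomp C (act g \<beta>) (act (\<phi> g \<beta>) (act h \<gamma>)))"
      using comp_assoc[OF m(1) act_closed[OF m(2,3)] _ c1 c3]
      by (simp add: act_mult act_closed cocycle_closed)
    also have "mcomp C (act g \<beta>) (act (\<phi> g \<beta>) (act h \<gamma>)) = act g (mcomp C \<beta> (act h \<gamma>))"
      using act_comp[OF m(2,3) act_closed[OF m(4,5)] c2] by simp
    finally have 1: "mcomp C (mcomp C \<alpha> (act g \<beta>)) (act (\<phi> g \<beta> \<otimes> h) \<gamma>)
        = mcomp C \<alpha> (act g (mcomp C \<beta> (act h \<gamma>)))" .
    have 2: "\<phi> (\<phi> g \<beta> \<otimes> h) \<gamma> \<otimes> k = \<phi> g (mcomp C \<beta> (act h \<gamma>)) \<otimes> (\<phi> h \<gamma> \<otimes> k)"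
      using cocycle_comp[OF m(2,3) act_closed[OF m(4,5)] c2]
      by (simp add: cocycle_mult cocycle_closed act_closed group_G.m_assoc)
    from 1 2 show ?thesis by (simp add: sel)
  qed
  show "mcomp ?D (rge ?D a) a = a" if "a \<in> Mor ?D" for a
    using that by (auto simp: sel act_one cocycle_one id_left)
  show "mcomp ?D a (src ?D a) = a" if "a \<in> Mor ?D" for a
    using that by (auto simp: sel act_inv' src_vert vm id_right cocycle_vert act_vert)
qed

lemma right_ideal_zappa_szep:
  assumes "\<alpha> \<in> Mor C" "g \<in> carrier G"
  shows "right_ideal (zappa_szep C G act \<phi>) (\<alpha>, g) = right_ideal C \<alpha> \<times> carrier G"
proof (intro equalityI subsetI)
  fix x assume "x \<in> right_ideal (zappa_szep C G act \<phi>) (\<alpha>, g)"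
  then obtain \<beta> h where *: "\<beta> \<in> Mor C" "h \<in> carrier G" "act (inv g) (src C \<alpha>) = rge C \<beta>"
    "x = (mcomp C \<alpha> (act g \<beta>), \<phi> g \<beta> \<otimes> h)"
    by (auto simp: right_ideal_def zappa_szep_def)
  with assms have "src C \<alpha> = rge C (act g \<beta>)" by (simp add: zs_composable_iff)
  with assms * act_closed[OF assms(2) *(1)] cocycle_closed[OF assms(2) *(1)]
  show "x \<in> right_ideal C \<alpha> \<times> carrier G"
    unfolding right_ideal_def by auto
next
  fix x assume "x \<in> right_ideal C \<alpha> \<times> carrier G"
  then obtain \<beta> k where *: "\<beta> \<in> Mor C" "rge C \<beta> = src C \<alpha>" "k \<in> carrier G" "x = (mcomp C \<alpha> \<beta>, k)"
    by (auto simp: right_ideal_def)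
  define \<beta>' where "\<beta>' = act (inv g) \<beta>"
  have \<beta>': "\<beta>' \<in> Mor C" "act g \<beta>' = \<beta>"
    using assms * by (simp_all add: \<beta>'_def act_closed act_inv')
  define h where "h = inv (\<phi> g \<beta>') \<otimes> k"
  have h: "h \<in> carrier G" "\<phi> g \<beta>' \<otimes> h = k"
    using assms * \<beta>' by (simp_all add: h_def cocycle_closed group_G.m_assoc[symmetric])
  have "act (inv g) (src C \<alpha>) = rge C \<beta>'"
    using zs_composable_iff[OF assms \<beta>'(1)] \<beta>'(2) *(2) by simp
  with * \<beta>' h show "x \<in> right_ideal (zappa_szep C G act \<phi>) (\<alpha>, g)"
    unfolding right_ideal_def zappa_szep_def
    by (intro CollectI exI[of _ "(\<beta>', h)"]) simp
qed

lemma finitely_aligned_lcsc_zappa_szep: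
  assumes "finitely_aligned_lcsc C"
  shows "finitely_aligned_lcsc (zappa_szep C G act \<phi>)" (is "finitely_aligned_lcsc ?D")
proof (intro finitely_aligned_lcsc.intro small_category_zappa_szep, unfold_locales)
  interpret fa: finitely_aligned_lcsc C by fact
  show "b = c"
    if abc: "a \<in> Mor ?D" "b \<in> Mor ?D" "c \<in> Mor ?D" "src ?D a = rge ?D b" "src ?D a = rge ?D c"
      "mcomp ?D a b = mcomp ?D a c" for a b c
  proof -
    obtain \<alpha> g \<beta> h \<gamma> k where [simp]: "a = (\<alpha>, g)" "b = (\<beta>, h)" "c = (\<gamma>, k)"
      by (cases a, cases b, cases c) blast
    have m: "\<alpha> \<in> Mor C" "g \<in> carrier G" "\<beta> \<in> Mor C" "h \<in> carrier G"
      "\<gamma> \<in> Mor C" "k \<in> carrier G"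
      using abc(1-3) by (auto simp: zappa_szep_def)
    have c: "src C \<alpha> = rge C (act g \<beta>)" "src C \<alpha> = rge C (act g \<gamma>)"
      using abc(4,5) zs_composable_iff[OF m(1,2,3)] zs_composable_iff[OF m(1,2,5)]
      by (simp_all add: zappa_szep_def)
    have e: "mcomp C \<alpha> (act g \<beta>) = mcomp C \<alpha> (act g \<gamma>)" "\<phi> g \<beta> \<otimes> h = \<phi> g \<gamma> \<otimes> k"
      using abc(6) by (simp_all add: zappa_szep_def)
    have "act g \<beta> = act g \<gamma>"
      by (rule fa.left_cancel[OF m(1) act_closed[OF m(2,3)] act_closed[OF m(2,5)] c e(1)])
    then have "\<beta> = \<gamma>" using act_inv m by metis
    with e(2) m show ?thesis by (simp add: cocycle_closed)
  qed
  show "finitely_aligned ?D"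
    unfolding finitely_aligned_def
  proof (intro ballI)
    fix a b assume ab: "a \<in> Mor ?D" "b \<in> Mor ?D"
    obtain \<alpha> g \<beta> h where [simp]: "a = (\<alpha>, g)" "b = (\<beta>, h)" by (cases a, cases b) blast
    have m: "\<alpha> \<in> Mor C" "g \<in> carrier G" "\<beta> \<in> Mor C" "h \<in> carrier G"
      using ab by (auto simp: zappa_szep_def)
    obtain F where F: "finite F" "F \<subseteq> Mor C"
      "right_ideal C \<alpha> \<inter> right_ideal C \<beta> = (\<Union>\<gamma>\<in>F. right_ideal C \<gamma>)"
      using fa.vee_exists[OF m(1,3)] unfolding is_vee_def by blast
    have "right_ideal ?D a \<inter> right_ideal ?D b
        = (right_ideal C \<alpha> \<inter> right_ideal C \<beta>) \<times> carrier G"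
      using m by (simp add: right_ideal_zappa_szep Times_Int_distrib1)
    also have "\<dots> = (\<Union>\<gamma>\<in>F. right_ideal C \<gamma> \<times> carrier G)"
      unfolding F(3) by blast
    also have "\<dots> = (\<Union>\<gamma>\<in>F. right_ideal ?D (\<gamma>, \<one>))"
      using F(2) by (intro SUP_cong refl) (simp add: right_ideal_zappa_szep subsetD)
    also have "\<dots> = (\<Union>d\<in>F \<times> {\<one>}. right_ideal ?D d)"
      by auto
    finally have eq: "right_ideal ?D a \<inter> right_ideal ?D b = (\<Union>d\<in>F \<times> {\<one>}. right_ideal ?D d)" .
    moreover have "F \<times> {\<one>} \<subseteq> Mor ?D" using F(2) by (auto simp: zappa_szep_def)
    moreover have "finite (F \<times> {\<one>})" using F(1) by simp
    ultimately show "\<exists>F'. finite F' \<and> F' \<subseteq> Mor ?D \<and>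
        right_ideal ?D a \<inter> right_ideal ?D b = (\<Union>d\<in>F'. right_ideal ?D d)"
      by (intro exI[of _ "F \<times> {\<one>}"] conjI)
  qed
qed

end

definition unitary_representation :: "('g, 'm) monoid_scheme \<Rightarrow> ('g \<Rightarrow> 'b::cstar_algebra multiplier) \<Rightarrow> bool"
  where "unitary_representation G U \<longleftrightarrow>
    (\<forall>g\<in>carrier G. (U g)\<^sup>\<star> * U g = 1 \<and> U g * (U g)\<^sup>\<star> = 1) \<and>
    (\<forall>g\<in>carrier G. \<forall>h\<in>carrier G. U (g \<otimes>\<^bsub>G\<^esub> h) = U g * U h)"

definition system_representation ::
    "'c smallcat \<Rightarrow> ('g, 'm) monoid_scheme \<Rightarrow> ('g \<Rightarrow> 'c \<Rightarrow> 'c) \<Rightarrow> ('g \<Rightarrow> 'c \<Rightarrow> 'g) \<Rightarrow>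
     ('c \<Rightarrow> 'b::cstar_algebra) \<Rightarrow> ('g \<Rightarrow> 'b multiplier) \<Rightarrow> bool"
  where "system_representation C G act \<phi> T U \<longleftrightarrow>
    cat_representation C T \<and> nondegenerate C T \<and> unitary_representation G U \<and>
    (\<forall>g\<in>carrier G. \<forall>\<alpha>\<in>Mor C. lmult (U g) (T \<alpha>) = rmult (T (act g \<alpha>)) (U (\<phi> g \<alpha>)))"

definition system_covariant ::
    "'c smallcat \<Rightarrow> ('g, 'm) monoid_scheme \<Rightarrow> ('g \<Rightarrow> 'c \<Rightarrow> 'c) \<Rightarrow> ('g \<Rightarrow> 'c \<Rightarrow> 'g) \<Rightarrow>
     ('c \<Rightarrow> 'b::cstar_algebra) \<Rightarrow> ('g \<Rightarrow> 'b multiplier) \<Rightarrow> bool"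
  where "system_covariant C G act \<phi> T U \<longleftrightarrow>
    system_representation C G act \<phi> T U \<and> covariant_representation C T"

definition rep_product :: "('c \<Rightarrow> 'b::cstar_algebra) \<Rightarrow> ('g \<Rightarrow> 'b multiplier) \<Rightarrow> 'c \<times> 'g \<Rightarrow> 'b"
  where "rep_product T U = (\<lambda>(\<alpha>, g). rmult (T \<alpha>) (U g))"

end

theory Submission
  imports Defs
begin

text \<open>
  Write \<open>D\<close> for the Zappa-Szep product and \<open>R\<close> for \<open>T \<times> U\<close>.  Both covariance conditions speak
  only about range projections and exhaustive sets, and neither of these sees the group coordinate.
  Since \<open>U\<^sub>g\<close> is unitary, the range projection of \<open>R (\<alpha>, g) = T \<alpha> U\<^sub>g\<close> is that of \<open>T \<alpha>\<close>
  (\<open>rep_product_range_projection\<close>).  The element \<open>(\<alpha>, g)\<close> generates the right ideal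
  \<open>\<alpha>C \<times> G\<close>, whatever \<open>g\<close> is (\<open>right_ideal_zappa_szep\<close>); so a subset of \<open>D\<close> is exhaustive at
  \<open>(v, 1)\<close> exactly when its projection to \<open>C\<close> is exhaustive at \<open>v\<close>
  (\<open>exhaustive_at_zappa_szep_iff\<close>).  A finite exhaustive set \<open>F\<close> of \<open>D\<close> therefore imposes on \<open>R\<close>
  the relation that its projection imposes on \<open>T\<close>, and every finite exhaustive set \<open>F\<close> of \<open>C\<close>
  is the projection of \<open>F \<times> {1}\<close>.

  Covariance of \<open>R\<close> includes that \<open>R\<close> is a representation of \<open>D\<close>
  (\<open>cat_representation_rep_product\<close>).  The commutation relation
  \<open>U\<^sub>g T \<alpha> = T (g\<alpha>) U\<^bsub>\<phi>(g,\<alpha>)\<^esub>\<close> gives the algebraic relations, and the relation on joins is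
  inherited from \<open>T\<close> because a choice of \<open>(\<alpha>, g) \<or> (\<beta>, h)\<close> projects to a choice of
  \<open>\<alpha> \<or> \<beta>\<close> (\<open>is_vee_fst_image\<close>).
\<close>

section \<open>Elements times multipliers\<close>

lemma rmult_times: "rmult b m * c = b * lmult m c"
  by transfer auto

lemma times_rmult: "a * rmult b m = rmult (a * b) m"
  by transfer auto

lemma lmult_times: "lmult m a * b = lmult m (a * b)"
  by transfer auto

lemma rmult_mult: "rmult b (m * n) = rmult (rmult b m) n"
  by transfer auto

lemma lmult_mult: "lmult (m * n) b = lmult m (lmult n b)"
  by transfer auto

lemma rmult_one: "rmult b 1 = b"
  by transfer auto

lemma lmult_one: "lmult 1 b = b"
  by transfer auto

lemma star_rmult: "(rmult b m)\<^sup>\<star> = lmult (m\<^sup>\<star>) (b\<^sup>\<star>)"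
  by transfer auto

text \<open>
  The two sides agree after left multiplication by any element, and \<open>x\<^sup>\<star> * x = 0\<close> forces
  \<open>x = 0\<close> by the C*-identity.
\<close>

lemma lmult_rmult: "lmult m (rmult b n) = rmult (lmult m b) n"
proof -
  have "a * lmult m (rmult b n) = a * rmult (lmult m b) n" for a
    by (metis rmult_times times_rmult)
  then have "x\<^sup>\<star> * (lmult m (rmult b n) - rmult (lmult m b) n) = 0" for x
    by (simp add: right_diff_distrib)
  then show ?thesis
    by (metis cstar_identity norm_zero power_eq_0_iff norm_eq_zero right_minus_eq)
qed

section \<open>Right ideals and exhaustive sets in the Zappa-Szep product\<close>

context category_system
begin

interpretation group_G: group G
  using group_hom by (simp add: group_hom_def)

abbreviation "ZS \<equiv> zappa_szep C G act \<phi>"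

lemma Mor_zappa_szep: "Mor ZS = Mor C \<times> carrier G"
  by (simp add: zappa_szep_def)

lemma rge_zappa_szep: "rge ZS (\<alpha>, g) = (rge C \<alpha>, \<one>)"
  by (simp add: zappa_szep_def)

text \<open>
  Independence passes to the projection because membership in a right ideal of the product
  depends on first coordinates only.
\<close>

lemma is_vee_fst_image:
  assumes "\<alpha> \<in> Mor C" "g \<in> carrier G" "\<beta> \<in> Mor C" "h \<in> carrier G"
    and vee: "is_vee ZS (\<alpha>, g) (\<beta>, h) F"
  shows "is_vee C \<alpha> \<beta> (fst ` F)"
proof -
  have F: "finite F" "F \<subseteq> Mor C \<times> carrier G" "independent_mor ZS F"
    and ideals: "right_ideal ZS (\<alpha>, g) \<inter> right_ideal ZS (\<beta>, h) = (\<Union>d\<in>F. right_ideal ZS d)"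
    using vee by (simp_all add: is_vee_def Mor_zappa_szep)
  have ideal: "right_ideal ZS d = right_ideal C (fst d) \<times> carrier G" if "d \<in> F" for d
    using that F(2) right_ideal_zappa_szep[of "fst d" "snd d"] by (auto simp: mem_Times_iff)
  have "(right_ideal C \<alpha> \<inter> right_ideal C \<beta>) \<times> carrier G
      = (\<Union>d\<in>F. right_ideal C (fst d) \<times> carrier G)"
    using ideals ideal assms by (simp add: right_ideal_zappa_szep Times_Int_distrib1)
  also have "\<dots> = (\<Union>\<gamma>\<in>fst ` F. right_ideal C \<gamma>) \<times> carrier G"
    by auto
  finally have "right_ideal C \<alpha> \<inter> right_ideal C \<beta> = (\<Union>\<gamma>\<in>fst ` F. right_ideal C \<gamma>)"
    using assms(2) by blast
  moreover have "independent_mor C (fst ` F)"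
    unfolding independent_mor_def
  proof (intro ballI impI)
    fix \<gamma> \<gamma>' assume "\<gamma> \<in> fst ` F" "\<gamma>' \<in> fst ` F" "\<gamma> \<noteq> \<gamma>'"
    then obtain d d' where d: "d \<in> F" "d' \<in> F" "\<gamma> = fst d" "\<gamma>' = fst d'" "d \<noteq> d'"
      by blast
    then have "d \<notin> right_ideal ZS d'"
      using F(3) by (simp add: independent_mor_def)
    moreover have "snd d \<in> carrier G"
      using F(2) d(1) by auto
    ultimately show "\<gamma> \<notin> right_ideal C \<gamma>'"
      using ideal[OF d(2)] d(3,4) by (simp add: mem_Times_iff)
  qed
  ultimately show ?thesis
    using F(1,2) by (auto simp: is_vee_def)
qed

lemma exhaustive_at_zappa_szep_iff:
  "exhaustive_at ZS (v, \<one>) F \<longleftrightarrow> F \<subseteq> Mor C \<times> carrier G \<and> exhaustive_at C v (fst ` F)"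
proof (cases "F \<subseteq> Mor C \<times> carrier G")
  case True
  have meet: "right_ideal ZS (\<alpha>, g) \<inter> right_ideal ZS d \<noteq> {}
      \<longleftrightarrow> right_ideal C \<alpha> \<inter> right_ideal C (fst d) \<noteq> {}"
    if "\<alpha> \<in> Mor C" "g \<in> carrier G" "d \<in> F" for \<alpha> g d
  proof -
    have "right_ideal ZS d = right_ideal C (fst d) \<times> carrier G"
      using that True right_ideal_zappa_szep[of "fst d" "snd d"] by (auto simp: mem_Times_iff)
    then have "right_ideal ZS (\<alpha>, g) \<inter> right_ideal ZS d
        = (right_ideal C \<alpha> \<inter> right_ideal C (fst d)) \<times> carrier G"
      using that by (simp add: right_ideal_zappa_szep Times_Int_distrib1)
    then show ?thesis
      using that(2) by blast
  qed
  have "F \<subseteq> {d \<in> Mor ZS. rge ZS d = (v, \<one>)} \<longleftrightarrow> fst ` F \<subseteq> {\<alpha> \<in> Mor C. rge C \<alpha> = v}"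
    using True by (auto simp: zappa_szep_def)
  moreover have "(\<forall>a\<in>Mor ZS. rge ZS a = (v, \<one>)
        \<longrightarrow> (\<exists>d\<in>F. right_ideal ZS a \<inter> right_ideal ZS d \<noteq> {}))
      \<longleftrightarrow> (\<forall>\<alpha>\<in>Mor C. rge C \<alpha> = v
        \<longrightarrow> (\<exists>\<beta>\<in>fst ` F. right_ideal C \<alpha> \<inter> right_ideal C \<beta> \<noteq> {}))" (is "?L \<longleftrightarrow> ?R")
  proof -
    have "?L \<longleftrightarrow> (\<forall>\<alpha>\<in>Mor C. \<forall>g\<in>carrier G. rge C \<alpha> = v
        \<longrightarrow> (\<exists>d\<in>F. right_ideal ZS (\<alpha>, g) \<inter> right_ideal ZS d \<noteq> {}))"
      by (auto simp: Mor_zappa_szep rge_zappa_szep)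
    also have "\<dots> \<longleftrightarrow> (\<forall>\<alpha>\<in>Mor C. \<forall>g\<in>carrier G. rge C \<alpha> = v
        \<longrightarrow> (\<exists>d\<in>F. right_ideal C \<alpha> \<inter> right_ideal C (fst d) \<noteq> {}))"
      using meet by (intro ball_cong imp_cong bex_cong refl) blast
    also have "\<dots> \<longleftrightarrow> ?R"
      using group_G.one_closed by auto
    finally show ?thesis .
  qed
  ultimately show ?thesis
    using True by (simp add: exhaustive_at_def)
next
  case False
  then show ?thesis by (auto simp: exhaustive_at_def Mor_zappa_szep)
qed

end

section \<open>The product representation\<close>

lemma unitary_representation_one:
  assumes "group G" "unitary_representation G U"
  shows "U \<one>\<^bsub>G\<^esub> = 1"
proof -
  interpret group G by fact
  let ?u = "U \<one>\<^bsub>G\<^esub>"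
  have "?u\<^sup>\<star> * ?u = 1" "?u * ?u = ?u"
    using assms(2) unfolding unitary_representation_def by (metis one_closed r_one)+
  then show ?thesis
    by (metis mult.assoc mult_1_left)
qed

lemma rep_product_range_projection:
  assumes "unitary_representation G U" "g \<in> carrier G"
  shows "rep_product T U (\<alpha>, g) * (rep_product T U (\<alpha>, g))\<^sup>\<star> = T \<alpha> * (T \<alpha>)\<^sup>\<star>"
  using assms
  by (simp add: rep_product_def unitary_representation_def star_rmult rmult_times
      lmult_mult[symmetric] lmult_one)

lemma image_range_projection_rep_product:
  assumes "unitary_representation G U" "F \<subseteq> Mor C \<times> carrier G"
  shows "(\<lambda>d. rep_product T U d * (rep_product T U d)\<^sup>\<star>) ` F
    = (\<lambda>\<alpha>. T \<alpha> * (T \<alpha>)\<^sup>\<star>) ` fst ` F"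
  unfolding image_image
  using assms by (intro image_cong refl) (auto simp: rep_product_range_projection)

context category_system
begin

interpretation group_G: group G
  using group_hom by (simp add: group_hom_def)

lemma cat_representation_rep_product:
  assumes sys: "system_representation C G act \<phi> T U"
  shows "cat_representation ZS (rep_product T U)"
proof -
  have rep: "cat_representation C T" and U: "unitary_representation G U"
    and comm: "\<And>g \<alpha>. g \<in> carrier G \<Longrightarrow> \<alpha> \<in> Mor C
      \<Longrightarrow> lmult (U g) (T \<alpha>) = rmult (T (act g \<alpha>)) (U (\<phi> g \<alpha>))"
    using sys by (auto simp: system_representation_def)
  have U_mult: "U (g \<otimes> h) = U g * U h" if "g \<in> carrier G" "h \<in> carrier G" for g h
    using U that by (simp add: unitary_representation_def)
  let ?R = "rep_product T U"
  show ?thesis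
    unfolding cat_representation_def
  proof (intro conjI ballI allI impI)
    fix a assume "a \<in> Mor ZS"
    then obtain \<alpha> g where a: "a = (\<alpha>, g)" and m: "\<alpha> \<in> Mor C" "g \<in> carrier G"
      by (auto simp: Mor_zappa_szep)
    define w where "w = act (inv g) (src C \<alpha>)"
    have "src C \<alpha> \<in> Vert C" "src C \<alpha> \<in> Mor C"
      using m src_vert vert_sub by auto
    then have w: "w \<in> Vert C" "w \<in> Mor C" "act g w = src C \<alpha>"
      using m by (auto simp: w_def act_vert act_closed act_inv')
    have "(?R a)\<^sup>\<star> * ?R a = lmult ((U g)\<^sup>\<star>) (rmult ((T \<alpha>)\<^sup>\<star> * T \<alpha>) (U g))"
      by (simp add: a rep_product_def star_rmult lmult_times times_rmult lmult_rmult)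
    also have "(T \<alpha>)\<^sup>\<star> * T \<alpha> = T (act g w)"
      using rep m w by (simp add: cat_representation_def)
    \<comment> \<open>At a vertex the cocycle is trivial, so \<open>U g\<close> passes through unchanged.\<close>
    also have "rmult (T (act g w)) (U g) = lmult (U g) (T w)"
      using comm[OF m(2) w(2)] cocycle_vert[OF m(2) w(1)] by simp
    also have "lmult ((U g)\<^sup>\<star>) (lmult (U g) (T w)) = T w"
      using U m by (simp add: lmult_mult[symmetric] lmult_one unitary_representation_def)
    also have "\<dots> = ?R (src ZS a)"
      using unitary_representation_one[OF group_G.group_axioms U]
      by (simp add: a zappa_szep_def rep_product_def rmult_one w_def)
    finally show "(?R a)\<^sup>\<star> * ?R a = ?R (src ZS a)" .
  next
    fix a b assume "a \<in> Mor ZS" "b \<in> Mor ZS" and ab: "src ZS a = rge ZS b"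
    then obtain \<alpha> g \<beta> h where a: "a = (\<alpha>, g)" and b: "b = (\<beta>, h)"
      and m: "\<alpha> \<in> Mor C" "g \<in> carrier G" "\<beta> \<in> Mor C" "h \<in> carrier G"
      by (auto simp: Mor_zappa_szep)
    have c: "src C \<alpha> = rge C (act g \<beta>)"
      using ab zs_composable_iff[OF m(1-3)] by (simp add: a b zappa_szep_def)
    have "?R a * ?R b = rmult (T \<alpha> * lmult (U g) (T \<beta>)) (U h)"
      by (simp add: a b rep_product_def rmult_times times_rmult lmult_rmult)
    also have "\<dots> = rmult (T \<alpha> * T (act g \<beta>)) (U (\<phi> g \<beta> \<otimes> h))"
      using m by (simp add: comm times_rmult U_mult cocycle_closed rmult_mult)
    also have "T \<alpha> * T (act g \<beta>) = T (mcomp C \<alpha> (act g \<beta>))"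
      using rep c m by (simp add: cat_representation_def act_closed)
    finally show "?R a * ?R b = ?R (mcomp ZS a b)"
      by (simp add: a b zappa_szep_def rep_product_def)
  next
    fix a b F assume "a \<in> Mor ZS" "b \<in> Mor ZS" and vee: "is_vee ZS a b F"
    then obtain \<alpha> g \<beta> h where a: "a = (\<alpha>, g)" and b: "b = (\<beta>, h)"
      and m: "\<alpha> \<in> Mor C" "g \<in> carrier G" "\<beta> \<in> Mor C" "h \<in> carrier G"
      by (auto simp: Mor_zappa_szep)
    have "is_join_of (T \<alpha> * (T \<alpha>)\<^sup>\<star> * (T \<beta> * (T \<beta>)\<^sup>\<star>)) ((\<lambda>\<gamma>. T \<gamma> * (T \<gamma>)\<^sup>\<star>) ` fst ` F)"
      using rep m is_vee_fst_image[OF m] vee by (simp add: cat_representation_def a b)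
    moreover have "F \<subseteq> Mor C \<times> carrier G"
      using vee by (simp add: is_vee_def Mor_zappa_szep)
    ultimately show "is_join_of (?R a * (?R a)\<^sup>\<star> * (?R b * (?R b)\<^sup>\<star>)) ((\<lambda>d. ?R d * (?R d)\<^sup>\<star>) ` F)"
      using m by (simp add: a b rep_product_range_projection[OF U]
          image_range_projection_rep_product[OF U])
  qed
qed

end

theorem corollary5p5:
  fixes C :: "'c smallcat" and G :: "('g, 'm) monoid_scheme"
    and act :: "'g \<Rightarrow> 'c \<Rightarrow> 'c" and \<phi> :: "'g \<Rightarrow> 'c \<Rightarrow> 'g"
    and T :: "'c \<Rightarrow> 'b::cstar_algebra" and U :: "'g \<Rightarrow> 'b multiplier"
  assumes "category_system C G act \<phi>"
    and "finitely_aligned_lcsc C"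
    and "system_representation C G act \<phi> T U"
  shows "system_covariant C G act \<phi> T U \<longleftrightarrow>
    covariant_representation (zappa_szep C G act \<phi>) (rep_product T U)"
proof -
  interpret category_system C G act \<phi> by fact
  interpret group_G: group G
    using group_hom by (simp add: group_hom_def)
  have rep: "cat_representation C T" and U: "unitary_representation G U"
    using assms(3) by (auto simp: system_representation_def)
  let ?R = "rep_product T U"
  have R_vert: "?R (v, \<one>\<^bsub>G\<^esub>) = T v" for v
    using unitary_representation_one[OF group_G.group_axioms U]
    by (simp add: rep_product_def rmult_one)
  have proj: "(\<lambda>d. ?R d * (?R d)\<^sup>\<star>) ` F = (\<lambda>\<alpha>. T \<alpha> * (T \<alpha>)\<^sup>\<star>) ` fst ` F"
    if "F \<subseteq> Mor C \<times> carrier G" for F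
    by (rule image_range_projection_rep_product[OF U that])
  have "(\<forall>v\<in>Vert C. \<forall>F. finite F \<and> exhaustive_at C v F \<longrightarrow>
        is_join_of (T v) ((\<lambda>\<alpha>. T \<alpha> * (T \<alpha>)\<^sup>\<star>) ` F))
    \<longleftrightarrow> (\<forall>d\<in>Vert ZS. \<forall>F. finite F \<and> exhaustive_at ZS d F \<longrightarrow>
        is_join_of (?R d) ((\<lambda>d. ?R d * (?R d)\<^sup>\<star>) ` F))" (is "?covT \<longleftrightarrow> ?covR")
  proof
    assume covT: ?covT
    show ?covR
    proof (intro ballI allI impI)
      fix d F assume "d \<in> Vert ZS" and F: "finite F \<and> exhaustive_at ZS d F"
      then obtain v where v: "d = (v, \<one>\<^bsub>G\<^esub>)" "v \<in> Vert C"
        by (auto simp: zappa_szep_def)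
      with F have "F \<subseteq> Mor C \<times> carrier G" "exhaustive_at C v (fst ` F)"
        by (simp_all add: exhaustive_at_zappa_szep_iff)
      with covT F v show "is_join_of (?R d) ((\<lambda>d. ?R d * (?R d)\<^sup>\<star>) ` F)"
        by (simp add: R_vert proj)
    qed
  next
    assume covR: ?covR
    show ?covT
    proof (intro ballI allI impI)
      fix v F assume v: "v \<in> Vert C" and F: "finite F \<and> exhaustive_at C v F"
      let ?F = "F \<times> {\<one>\<^bsub>G\<^esub>}"
      have fst_F: "fst ` ?F = F" and sub: "?F \<subseteq> Mor C \<times> carrier G"
        using F by (auto simp: exhaustive_at_def)
      have "exhaustive_at ZS (v, \<one>\<^bsub>G\<^esub>) ?F"
        using F sub fst_F by (simp add: exhaustive_at_zappa_szep_iff)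
      with F have exh: "finite ?F \<and> exhaustive_at ZS (v, \<one>\<^bsub>G\<^esub>) ?F"
        by simp
      have vert: "(v, \<one>\<^bsub>G\<^esub>) \<in> Vert ZS"
        using v by (simp add: zappa_szep_def)
      have "is_join_of (?R (v, \<one>\<^bsub>G\<^esub>)) ((\<lambda>d. ?R d * (?R d)\<^sup>\<star>) ` ?F)"
        by (rule mp[OF spec[OF bspec[OF covR vert]] exh])
      then show "is_join_of (T v) ((\<lambda>\<alpha>. T \<alpha> * (T \<alpha>)\<^sup>\<star>) ` F)"
        by (simp only: R_vert proj[OF sub] fst_F)
    qed
  qed
  then show ?thesis
    unfolding system_covariant_def covariant_representation_def
    by (simp only: assms(3) rep cat_representation_rep_product[OF assms(3)] simp_thms)
qed

end
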